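(* Let $m\ge 1$ be an integer, let $n\ge 2$, and let $D_n$ be the depth of a node labeled $n$ in an $m$-ary recursive tree. Then $$D_n \overset{\mathcal L}{=} 1 + \mathrm{Ber}\Big(\frac{m}{m+1}\Big)+\mathrm{Ber}\Big(\frac{m}{2m+1}\Big)+\cdots+\mathrm{Ber}\Big(\frac{m}{m(n-2)+1}\Big),$$ where the Bernoulli random variables $\mathrm{Ber}\big(\frac{m}{mk+1}\big)$, $k=1,\dots,n-2$, in the sum are independent; for $n=2$ the sum of Bernoulli random variables is empty and interpreted as $0$.
   Context: Fix an integer $m\ge 1$. The $m$-ary recursive tree grows as follows. It starts as a single root node labeled $1$. For each $n\ge 1$, given the tree with highest label $n$ (which has $m(n-1)+1$ nodes), one of its nodes is selected uniformly at random, and $m$ new nodes, all receiving the label $n+1$, are attached as children of the selected node. The depth of a node is its edge distance to the root; all nodes labeled $n$ have the same depth, denoted $D_n$. $\mathrm{Ber}(p)$ denotes a Bernoulli random variable with success probability $p$, and $\overset{\mathcal L}{=}$ denotes equality in law. *)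

theory Defs
  imports "HOL-Probability.Probability"
begin

text \<open>
  The node \<open>(l, i)\<close> is the \<open>i\<close>-th of the nodes that carry the label \<open>l\<close>;
  the root is the only node with label \<open>1\<close>.
\<close>

type_synonym node = "nat \<times> nat"

text \<open>Edges point from parent to child.\<close>

datatype tree = Tree (nodes: "node set") (edges: "(node \<times> node) set")

definition root_node :: node where
  "root_node = (1, 0)"

definition root_tree :: tree where
  "root_tree = Tree {root_node} {}"

definition attach :: "nat \<Rightarrow> nat \<Rightarrow> node \<Rightarrow> tree \<Rightarrow> tree" where
  "attach m l v t =
     Tree (nodes t \<union> {l} \<times> {..<m}) (edges t \<union> {v} \<times> ({l} \<times> {..<m}))"

text \<open>
  The law of the tree with highest label \<open>n\<close>. The tree records the labels, so it determines
  all earlier stages of its growth. The value at \<open>n = 0\<close> has no meaning.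
\<close>

fun recursive_tree :: "nat \<Rightarrow> nat \<Rightarrow> tree pmf" where
  "recursive_tree m 0 = return_pmf root_tree"
| "recursive_tree m (Suc 0) = return_pmf root_tree"
| "recursive_tree m (Suc (Suc n)) =
     bind_pmf (recursive_tree m (Suc n)) (\<lambda>t.
       map_pmf (\<lambda>v. attach m (Suc (Suc n)) v t) (pmf_of_set (nodes t)))"

text \<open>Graph distance to the root: the least length of an undirected walk.\<close>

definition depth :: "tree \<Rightarrow> node \<Rightarrow> nat" where
  "depth t v = (LEAST k. (root_node, v) \<in> (edges t \<union> (edges t)\<inverse>) ^^ k)"

lemma nodes_recursive_tree:
  assumes "t \<in> set_pmf (recursive_tree m n)"
  shows "nodes t = insert root_node ({2..n} \<times> {..<m})"
  using assms
proof (induction m n arbitrary: t rule: recursive_tree.induct)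
  case (3 m n)
  from "3.prems" obtain s v where s: "s \<in> set_pmf (recursive_tree m (Suc n))"
    and t: "t = attach m (Suc (Suc n)) v s"
    by (simp only: recursive_tree.simps set_bind_pmf set_map_pmf) blast
  have "{2..Suc (Suc n)} = insert (Suc (Suc n)) {2..Suc n}"
    by auto
  then show ?case
    using "3.IH"[OF s] t by (auto simp: attach_def)
qed (auto simp: root_tree_def)

lemma card_nodes_recursive_tree:
  assumes "t \<in> set_pmf (recursive_tree m n)"
  shows "card (nodes t) = m * (n - 1) + 1"
proof -
  have "root_node \<notin> {2..n} \<times> {..<m}"
    by (simp add: root_node_def)
  then show ?thesis
    by (simp add: nodes_recursive_tree[OF assms] card_cartesian_product)
qed

end

theory Submission
  imports Defs
begin

text \<open>
  Let \<open>U\<^sub>n\<close> be the depth of a uniformly random node of the tree with highest label \<open>n\<close>. A node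
  labelled \<open>n + 1\<close> hangs below such a node, so its depth is \<open>1 + U\<^sub>n\<close> in law. A uniform node of
  the tree with highest label \<open>n + 1\<close> is one of the \<open>m\<close> new nodes with probability
  \<open>m / (m * n + 1)\<close>, and then has depth \<open>1 + U\<^sub>n\<close>; otherwise it is a uniform old node, of depth
  \<open>U\<^sub>n\<close>. Hence \<open>U\<close> at \<open>n + 1\<close> is \<open>U\<^sub>n\<close> plus an independent Bernoulli variable, and \<open>U\<^sub>1 = 0\<close>.
\<close>

section \<open>Depth in a growing tree\<close>

lemma relpow_mono:
  fixes R S :: "('a \<times> 'a) set"
  assumes "R \<subseteq> S"
  shows "R ^^ k \<subseteq> S ^^ k"
  by (induction k) (use assms in \<open>auto intro: relcomp_mono\<close>)

text \<open>A potential \<open>h\<close> that rises by one along each edge changes by at most one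
  per undirected step, so no walk from the root to \<open>w\<close> is shorter than
  \<open>h w\<close>; the directed walk attains this bound.\<close>

lemma depth_eqI:
  assumes root: "h root_node = 0"
    and step: "\<And>u v. (u, v) \<in> edges t \<Longrightarrow> h v = Suc (h u)"
    and walk: "(root_node, w) \<in> edges t ^^ h w"
  shows "depth t w = h w"
  unfolding depth_def
proof (rule Least_equality)
  show "(root_node, w) \<in> (edges t \<union> (edges t)\<inverse>) ^^ h w"
    using walk relpow_mono[of "edges t" "edges t \<union> (edges t)\<inverse>" "h w"] by blast
next
  fix k
  assume "(root_node, w) \<in> (edges t \<union> (edges t)\<inverse>) ^^ k"
  then show "h w \<le> k"
  proof (induction k arbitrary: w)
    case 0
    then show ?case using root by simp
  next
    case (Suc k)
    then obtain x where "(root_node, x) \<in> (edges t \<union> (edges t)\<inverse>) ^^ k"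
      and "(x, w) \<in> edges t \<union> (edges t)\<inverse>"
      by auto
    with Suc.IH[of x] step[of x w] step[of w x] show ?case by auto
  qed
qed

lemma depth_root_node [simp]: "depth t root_node = 0"
  unfolding depth_def by (rule Least_eq_0) simp

text \<open>The invariant of growth: \<open>depth t\<close> is itself a potential as in
  \<open>depth_eqI\<close>, and every node is reached from the root along directed edges.\<close>

definition layered :: "tree \<Rightarrow> bool" where
  "layered t \<longleftrightarrow> root_node \<in> nodes t \<and> edges t \<subseteq> nodes t \<times> nodes t \<and>
     (\<forall>(u, v) \<in> edges t. depth t v = Suc (depth t u)) \<and>
     (\<forall>w \<in> nodes t. (root_node, w) \<in> edges t ^^ depth t w)"

lemma layered_root_tree: "layered root_tree"
  by (simp add: layered_def root_tree_def)

text \<open>Extending \<open>depth t\<close> by \<open>Suc (depth t v)\<close> on the new nodes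
  gives a potential on the larger tree, which \<open>depth_eqI\<close> identifies with its depth.
  Freshness keeps the new edges from ending in old nodes.\<close>

lemma
  assumes t: "layered t" and v: "v \<in> nodes t" and fresh: "nodes t \<inter> {l} \<times> {..<m} = {}"
  shows layered_attach: "layered (attach m l v t)"
    and depth_attach_old: "w \<in> nodes t \<Longrightarrow> depth (attach m l v t) w = depth t w"
    and depth_attach_new: "w \<in> {l} \<times> {..<m} \<Longrightarrow> depth (attach m l v t) w = Suc (depth t v)"
proof -
  define t' where "t' = attach m l v t"
  define h where "h w = (if w \<in> nodes t then depth t w else Suc (depth t v))" for w
  have nodes': "nodes t' = nodes t \<union> {l} \<times> {..<m}"
    and edges': "edges t' = edges t \<union> {v} \<times> ({l} \<times> {..<m})"
    by (simp_all add: t'_def attach_def)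
  have root: "root_node \<in> nodes t" and inside: "edges t \<subseteq> nodes t \<times> nodes t"
    and step: "\<And>u w. (u, w) \<in> edges t \<Longrightarrow> depth t w = Suc (depth t u)"
    and walk: "\<And>w. w \<in> nodes t \<Longrightarrow> (root_node, w) \<in> edges t ^^ depth t w"
    using t by (auto simp: layered_def)
  have new: "w \<notin> nodes t" if "w \<in> {l} \<times> {..<m}" for w
    using fresh that by blast
  have h_step: "h w = Suc (h u)" if "(u, w) \<in> edges t'" for u w
  proof (cases "(u, w) \<in> edges t")
    case True
    then show ?thesis using inside step by (auto simp: h_def)
  next
    case False
    then have "u = v" "w \<in> {l} \<times> {..<m}" using that by (auto simp: edges')
    then show ?thesis using new v by (simp add: h_def)
  qed
  have old_walk: "(root_node, w) \<in> edges t' ^^ depth t w" if "w \<in> nodes t" for w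
    using walk[OF that] relpow_mono[of "edges t" "edges t'" "depth t w"] by (auto simp: edges')
  have h_walk: "(root_node, w) \<in> edges t' ^^ h w" if "w \<in> nodes t'" for w
  proof (cases "w \<in> nodes t")
    case True
    then show ?thesis using old_walk by (simp add: h_def)
  next
    case False
    then have "(v, w) \<in> edges t'" using that by (auto simp: nodes' edges')
    with old_walk[OF v] False show ?thesis by (auto simp: h_def)
  qed
  have depth': "depth t' w = h w" if "w \<in> nodes t'" for w
    using root by (intro depth_eqI h_step h_walk that) (auto simp: h_def)
  show "depth (attach m l v t) w = depth t w" if "w \<in> nodes t"
    using depth'[of w] that by (simp add: t'_def[symmetric] nodes' h_def)
  show "depth (attach m l v t) w = Suc (depth t v)" if "w \<in> {l} \<times> {..<m}"
    using depth'[of w] that new[OF that] by (simp add: t'_def[symmetric] nodes' h_def)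
  have inside': "edges t' \<subseteq> nodes t' \<times> nodes t'"
    using inside v by (auto simp: nodes' edges')
  have "depth t' w = Suc (depth t' u)" if "(u, w) \<in> edges t'" for u w
    using h_step[OF that] depth'[of u] depth'[of w] inside' that by auto
  moreover have "(root_node, w) \<in> edges t' ^^ depth t' w" if "w \<in> nodes t'" for w
    using h_walk[OF that] depth'[OF that] by simp
  moreover have "root_node \<in> nodes t'"
    using root by (simp add: nodes')
  ultimately show "layered (attach m l v t)"
    using inside' unfolding t'_def[symmetric] layered_def by blast
qed

lemma recursive_tree_Suc:
  assumes "n \<ge> 1"
  shows "recursive_tree m (Suc n) =
    recursive_tree m n \<bind> (\<lambda>t. map_pmf (\<lambda>v. attach m (Suc n) v t) (pmf_of_set (nodes t)))"
  using assms by (cases n) simp_all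

lemma recursive_tree_simps:
  assumes "t \<in> set_pmf (recursive_tree m n)"
  shows finite_nodes: "finite (nodes t)"
    and nodes_nonempty: "nodes t \<noteq> {}"
    and fresh_label: "n \<ge> 1 \<Longrightarrow> nodes t \<inter> {Suc n} \<times> {..<m} = {}"
  by (auto simp: nodes_recursive_tree[OF assms] root_node_def)

lemma layered_recursive_tree:
  assumes "t \<in> set_pmf (recursive_tree m n)"
  shows "layered t"
  using assms
proof (induction n arbitrary: t)
  case 0
  then show ?case by (simp add: layered_root_tree)
next
  case (Suc n)
  show ?case
  \<comment> \<open>Stages 0 and 1 are both the root tree; attachment starts only after stage
    1.\<close>
  proof (cases "n = 0")
    case True
    with Suc.prems show ?thesis by (simp add: layered_root_tree)
  next
    case False
    with Suc.prems obtain s v where s: "s \<in> set_pmf (recursive_tree m n)"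
      and v: "v \<in> set_pmf (pmf_of_set (nodes s))" and t: "t = attach m (Suc n) v s"
      by (auto simp: recursive_tree_Suc)
    have "v \<in> nodes s"
      using v finite_nodes[OF s] nodes_nonempty[OF s] by simp
    with False show ?thesis
      unfolding t by (intro layered_attach Suc.IH s fresh_label) auto
  qed
qed

section \<open>Laws of depths\<close>

definition uniform_depth :: "nat \<Rightarrow> nat \<Rightarrow> nat pmf" where
  "uniform_depth m n =
     recursive_tree m n \<bind> (\<lambda>t. map_pmf (depth t) (pmf_of_set (nodes t)))"

text \<open>Choosing a block with probability proportional to its size and then a uniform point in
  it gives every point the same mass.\<close>

lemma pmf_of_set_Un_disjoint:
  assumes "finite A" "finite B" "A \<noteq> {}" "B \<noteq> {}" "A \<inter> B = {}"
  shows "pmf_of_set (A \<union> B) =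
    bernoulli_pmf (card B / (card A + card B)) \<bind> (\<lambda>b. pmf_of_set (if b then B else A))"
proof (rule pmf_eqI)
  fix x
  have pos: "card A > 0" "card B > 0"
    using assms by (auto simp: card_gt_0_iff)
  have "1 - real (card B) / (card A + card B) = card A / (card A + card B)"
    using pos by (simp add: field_simps)
  moreover have "real (card B) / (card A + card B) \<le> 1"
    using pos by simp
  ultimately show "pmf (pmf_of_set (A \<union> B)) x =
    pmf (bernoulli_pmf (card B / (card A + card B)) \<bind> (\<lambda>b. pmf_of_set (if b then B else A))) x"
    using assms pos by (auto simp: pmf_bind card_Un_disjoint indicator_def)
qed

lemma map_pmf_const_on:
  assumes "\<And>x. x \<in> set_pmf p \<Longrightarrow> f x = c"
  shows "map_pmf f p = return_pmf c"
  using map_pmf_cong[of p p f "\<lambda>_. c"] assms by simp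

text \<open>The number of nodes is deterministic, so the coin deciding between new and old nodes has
  the same parameter for every tree and every parent. It can therefore be drawn first, which yields
  independence.\<close>

lemma uniform_depth_Suc:
  assumes "m \<ge> 1" "n \<ge> 1"
  shows "uniform_depth m (Suc n) =
    bernoulli_pmf (real m / (real m * real n + 1)) \<bind>
      (\<lambda>b. map_pmf (\<lambda>d. of_bool b + d) (uniform_depth m n))"
proof -
  let ?Ber = "bernoulli_pmf (real m / (real m * real n + 1))"
  let ?unif = "\<lambda>t. pmf_of_set (nodes t)"
  let ?new = "{Suc n} \<times> {..<m}"
  \<comment> \<open>Tree and parent are fixed here; on success the depth is constant because all new
    nodes are siblings.\<close>
  have split: "map_pmf (depth (attach m (Suc n) v t)) (?unif (attach m (Suc n) v t)) =
      ?Ber \<bind> (\<lambda>b. if b then return_pmf (Suc (depth t v)) else map_pmf (depth t) (?unif t))"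
    if t: "t \<in> set_pmf (recursive_tree m n)" and v: "v \<in> nodes t" for t v
  proof -
    let ?t' = "attach m (Suc n) v t"
    note fin = finite_nodes[OF t] nodes_nonempty[OF t]
    note fresh = fresh_label[OF t \<open>n \<ge> 1\<close>]
    note attached = layered_recursive_tree[OF t] v fresh
    have new_ne: "?new \<noteq> {}" using \<open>m \<ge> 1\<close> by (simp add: lessThan_empty_iff)
    have "card ?new = m" by (simp add: card_cartesian_product)
    \<comment> \<open>The old tree has \<open>m * (n - 1) + 1\<close> nodes;
      \<open>n \<ge> 1\<close> makes this natural subtraction exact.\<close>
    moreover have "real (card (nodes t)) + real m = real m * real n + 1"
      using \<open>n \<ge> 1\<close> by (simp add: card_nodes_recursive_tree[OF t] of_nat_diff algebra_simps)
    ultimately have "?unif ?t' = ?Ber \<bind> (\<lambda>b. pmf_of_set (if b then ?new else nodes t))"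
      using pmf_of_set_Un_disjoint[OF _ _ _ new_ne fresh] fin by (simp add: attach_def)
    moreover have "map_pmf (depth ?t') (pmf_of_set ?new) = return_pmf (Suc (depth t v))"
      using new_ne by (intro map_pmf_const_on depth_attach_new attached) simp
    moreover have "map_pmf (depth ?t') (?unif t) = map_pmf (depth t) (?unif t)"
      using fin by (intro map_pmf_cong refl depth_attach_old attached) simp
    ultimately show ?thesis
      by (auto simp: map_bind_pmf intro!: bind_pmf_cong)
  qed
  have "uniform_depth m (Suc n) =
      recursive_tree m n \<bind> (\<lambda>t. ?unif t \<bind> (\<lambda>v.
        map_pmf (depth (attach m (Suc n) v t)) (?unif (attach m (Suc n) v t))))"
    using \<open>n \<ge> 1\<close> by (simp add: uniform_depth_def recursive_tree_Suc bind_assoc_pmf bind_map_pmf)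
  also have "\<dots> = recursive_tree m n \<bind> (\<lambda>t. ?unif t \<bind> (\<lambda>v. ?Ber \<bind>
        (\<lambda>b. if b then return_pmf (Suc (depth t v)) else map_pmf (depth t) (?unif t))))"
    using finite_nodes nodes_nonempty by (intro bind_pmf_cong refl split) auto
  also have "\<dots> = recursive_tree m n \<bind> (\<lambda>t. ?Ber \<bind> (\<lambda>b. ?unif t \<bind>
        (\<lambda>v. if b then return_pmf (Suc (depth t v)) else map_pmf (depth t) (?unif t))))"
    by (subst bind_commute_pmf) (rule refl)
  also have "\<dots> = ?Ber \<bind> (\<lambda>b. recursive_tree m n \<bind> (\<lambda>t. ?unif t \<bind>
        (\<lambda>v. if b then return_pmf (Suc (depth t v)) else map_pmf (depth t) (?unif t))))"
    by (rule bind_commute_pmf)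
  \<comment> \<open>On success the depth comes from the uniform parent \<open>v\<close>; on failure
    \<open>v\<close> is discarded and a second uniform node of the same tree supplies it. Either way
    it has the law \<open>uniform_depth m n\<close> before the shift by the coin.\<close>
  also have "\<dots> = ?Ber \<bind> (\<lambda>b. map_pmf (\<lambda>d. of_bool b + d) (uniform_depth m n))"
    by (intro bind_pmf_cong refl)
      (auto simp: uniform_depth_def map_bind_pmf map_pmf_comp map_pmf_def[symmetric])
  finally show ?thesis .
qed

text \<open>Stage 1 has depth 0 and no coin; each later stage adds one, so stage
  \<open>Suc n\<close> carries \<open>n\<close> coins.\<close>

lemma uniform_depth_eq_sum_bernoulli:
  assumes "m \<ge> 1"
  shows "uniform_depth m (Suc n) =
    map_pmf (\<lambda>B. \<Sum>k = 1..n. of_bool (B k))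
      (Pi_pmf {1..n} False (\<lambda>k. bernoulli_pmf (real m / (real m * real k + 1))))"
proof (induction n)
  case 0
  show ?case
    by (simp add: uniform_depth_def bind_return_pmf root_tree_def pmf_of_set_singleton)
next
  case (Suc n)
  let ?Ber = "\<lambda>k. bernoulli_pmf (real m / (real m * real k + 1))"
  let ?S = "\<lambda>n B. \<Sum>k = 1..n. of_bool (B k) :: nat"
  \<comment> \<open>Independence lets the last coordinate be drawn separately; writing it at
    \<open>Suc n\<close> leaves the sum over \<open>{1..n}\<close> unchanged.\<close>
  have Pi_Suc: "Pi_pmf {1..Suc n} False ?Ber =
      ?Ber (Suc n) \<bind> (\<lambda>b. map_pmf (\<lambda>B. B(Suc n := b)) (Pi_pmf {1..n} False ?Ber))"
    using Pi_pmf_insert'[of "{1..n}" "Suc n" False ?Ber]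
    by (simp add: atLeastAtMostSuc_conv map_pmf_def)
  have S_Suc: "?S (Suc n) (B(Suc n := b)) = of_bool b + ?S n B" for B b
  proof -
    have "?S n (B(Suc n := b)) = ?S n B"
      by (intro sum.cong) auto
    then show ?thesis by (simp del: sum_of_bool_eq)
  qed
  have "map_pmf (?S (Suc n)) (Pi_pmf {1..Suc n} False ?Ber) =
      ?Ber (Suc n) \<bind> (\<lambda>b. map_pmf (\<lambda>d. of_bool b + d) (map_pmf (?S n) (Pi_pmf {1..n} False ?Ber)))"
    by (simp only: Pi_Suc map_bind_pmf map_pmf_comp S_Suc)
  then show ?case
    using uniform_depth_Suc[OF assms, of "Suc n"] Suc.IH by simp
qed

lemma depth_law_new_label:
  assumes "n \<ge> 1" "i < m"
  shows "map_pmf (\<lambda>t. depth t (Suc n, i)) (recursive_tree m (Suc n)) =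
    map_pmf Suc (uniform_depth m n)"
proof -
  have "depth (attach m (Suc n) v t) (Suc n, i) = Suc (depth t v)"
    if t: "t \<in> set_pmf (recursive_tree m n)" and "v \<in> nodes t" for t v
    using assms that by (intro depth_attach_new layered_recursive_tree[OF t] fresh_label[OF t]) auto
  then show ?thesis
    using assms finite_nodes nodes_nonempty
    by (auto simp: recursive_tree_Suc uniform_depth_def map_bind_pmf map_pmf_comp
        intro!: bind_pmf_cong map_pmf_cong)
qed

text \<open>Later attachments leave the depths of existing nodes alone, so the law can be read off
  at the stage where the label appears. For \<open>n \<ge> 2\<close> every \<open>(n, i)\<close>
  with \<open>i < m\<close> is a node from stage \<open>n\<close> on.\<close>

lemma depth_law_stable:
  assumes "N \<ge> n" "n \<ge> 2" "i < m"
  shows "map_pmf (\<lambda>t. depth t (n, i)) (recursive_tree m N) =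
    map_pmf (\<lambda>t. depth t (n, i)) (recursive_tree m n)"
  using assms(1)
proof (induction N rule: dec_induct)
  case base
  show ?case ..
next
  case (step N)
  have "depth (attach m (Suc N) v t) (n, i) = depth t (n, i)"
    if t: "t \<in> set_pmf (recursive_tree m N)" and "v \<in> nodes t" for t v
    using assms step.hyps that
    by (intro depth_attach_old layered_recursive_tree[OF t] fresh_label[OF t])
      (auto simp: nodes_recursive_tree[OF t])
  \<comment> \<open>The depth is the same for every parent \<open>v\<close>, so the random choice of
    \<open>v\<close> collapses to a point mass.\<close>
  then have "map_pmf (\<lambda>v. depth (attach m (Suc N) v t) (n, i)) (pmf_of_set (nodes t)) =
      return_pmf (depth t (n, i))" if "t \<in> set_pmf (recursive_tree m N)" for t
    using that finite_nodes[OF that] nodes_nonempty[OF that] by (intro map_pmf_const_on) auto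
  then have "map_pmf (\<lambda>t. depth t (n, i)) (recursive_tree m (Suc N)) =
      recursive_tree m N \<bind> (\<lambda>t. return_pmf (depth t (n, i)))"
    using assms step.hyps
    by (auto simp: recursive_tree_Suc map_bind_pmf map_pmf_comp intro!: bind_pmf_cong)
  then show ?case
    using step.IH by (simp add: map_pmf_def)
qed

theorem theorem4p1:
  fixes m n N i :: nat
  assumes "m \<ge> 1" and "n \<ge> 2" and "N \<ge> n" and "i < m"
  shows "map_pmf (\<lambda>t. depth t (n, i)) (recursive_tree m N) =
         map_pmf (\<lambda>B. 1 + (\<Sum>k = 1..n - 2. of_bool (B k)))
           (Pi_pmf {1..n - 2} False (\<lambda>k. bernoulli_pmf (real m / (real m * real k + 1))))"
proof -
  \<comment> \<open>Label \<open>n\<close> hangs below a uniform node of stage \<open>Suc r\<close>,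
    which accounts for \<open>r = n - 2\<close> coins.\<close>
  obtain r where n: "n = Suc (Suc r)"
    using \<open>n \<ge> 2\<close> by (metis add_2_eq_Suc le_Suc_ex)
  have "map_pmf (\<lambda>t. depth t (n, i)) (recursive_tree m N) = map_pmf Suc (uniform_depth m (Suc r))"
    using depth_law_stable[of n N i m] depth_law_new_label[of "Suc r" i m] assms n by simp
  also have "\<dots> = map_pmf (\<lambda>B. 1 + (\<Sum>k = 1..r. of_bool (B k)))
      (Pi_pmf {1..r} False (\<lambda>k. bernoulli_pmf (real m / (real m * real k + 1))))"
    unfolding uniform_depth_eq_sum_bernoulli[OF \<open>m \<ge> 1\<close>] by (simp add: map_pmf_comp)
  finally show ?thesis
    using n by simp
qed

end
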